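(* Let $C_{\mathcal{A}}=(\mathcal{A},\mathfrak{g}_D,M,\varphi)$ be a projective real calculus where $\dim\mathfrak{g}=n$. Then there exist an $\mathbb{R}$-linear map $\tilde{\varphi}:\mathfrak{g}\rightarrow\mathcal{A}^n$ and a projection $P:\mathcal{A}^n\rightarrow\mathcal{A}^n$ such that $(\mathcal{A},\mathfrak{g}_D,P(\mathcal{A}^n),P\circ\tilde{\varphi})$ is a real calculus isomorphic to $C_{\mathcal{A}}$: $$(\mathcal{A},\mathfrak{g}_D,P(\mathcal{A}^n),P\circ\tilde{\varphi})\simeq C_{\mathcal{A}}.$$
   Context: All $*$-algebras are complex. A hermitian derivation of a unital $*$-algebra $\mathcal{A}$ is a derivation $d$ with $d(a^* )=d(a)^*$ for all $a$. Real calculus: let $\mathcal{A}$ be a unital $*$-algebra, $\mathfrak{g}$ a real Lie algebra with a faithful representation $D:\mathfrak{g}\to\mathrm{Der}(\mathcal{A})$ (the pair is written $\mathfrak{g}_D$) such that $D(\partial)$ is a hermitian derivation for all $\partial\in\mathfrak{g}$, $M$ a right $\mathcal{A}$-module, and $\varphi:\mathfrak{g}\to M$ an $\mathbb{R}$-linear map such that $\varphi(\mathfrak{g})$ generates $M$ as an $\mathcal{A}$-module. Then $(\mathcal{A},\mathfrak{g}_D,M,\varphi)$ is a real calculus over $\mathcal{A}$. One writes $\partial(a)$ for $D(\partial)(a)$. The real calculus is called projective if $M$ is a projective module. A projection $P:\mathcal{A}^n\to\mathcal{A}^n$ is a right $\mathcal{A}$-module homomorphism with $P^2=P$; $\mathcal{A}^n$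 is the free right module. Isomorphism: given real calculi $C_{\mathcal{A}}=(\mathcal{A},\mathfrak{g}_D,M,\varphi)$ and $C_{\mathcal{A}'}=(\mathcal{A}',\mathfrak{g}'_{D'},M',\varphi')$, a real calculus homomorphism $C_{\mathcal{A}}\to C_{\mathcal{A}'}$ is a triple $(\phi,\psi,\hat{\psi})$ where $\phi:\mathcal{A}\to\mathcal{A}'$ is a $*$-algebra homomorphism, $\psi:\mathfrak{g}'\to\mathfrak{g}$ is a Lie algebra homomorphism with $\phi(\psi(\delta)(a))=\delta(\phi(a))$ for all $\delta\in\mathfrak{g}'$, $a\in\mathcal{A}$, and, with $\Psi=\varphi\circ\psi$ and $M_\Psi\subseteq M$ the submodule generated by $\Psi(\mathfrak{g}')$, $\hat{\psi}:M_\Psi\to M'$ is an additive map with $\hat{\psi}(ma)=\hat{\psi}(m)\phi(a)$ for $m\in M_\Psi,a\in\mathcal{A}$ and $\hat{\psi}(\Psi(\delta))=\varphi'(\delta)$ for $\delta\in\mathfrak{g}'$. It is an isomorphism if $\phi$ and $\psi$ are isomorphisms and $\hat{\psi}$ is a bijection. *)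

theory Defs
  imports Complex_Main "HOL-Library.Function_Algebras"
begin

section \<open>Unital *-algebras and derivations\<close>

text \<open>
  Built on \<^class>\<open>ring\<close> and \<^class>\<open>monoid_mult\<close> rather than \<^class>\<open>ring_1\<close>, so that the
  zero algebra is not excluded.
\<close>

class complex_star_algebra = ring + monoid_mult +
  fixes scaleC :: "complex \<Rightarrow> 'a \<Rightarrow> 'a"
    and star :: "'a \<Rightarrow> 'a"
  assumes scaleC_add_right: "scaleC z (a + b) = scaleC z a + scaleC z b"
    and scaleC_add_left: "scaleC (z + w) a = scaleC z a + scaleC w a"
    and scaleC_scaleC: "scaleC z (scaleC w a) = scaleC (z * w) a"
    and scaleC_one: "scaleC 1 a = a"
    and scaleC_mult_left: "scaleC z a * b = scaleC z (a * b)"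
    and scaleC_mult_right: "a * scaleC z b = scaleC z (a * b)"
    and star_star: "star (star a) = a"
    and star_add: "star (a + b) = star a + star b"
    and star_scaleC: "star (scaleC z a) = scaleC (cnj z) (star a)"
    and star_mult: "star (a * b) = star b * star a"

definition derivation :: "('a::complex_star_algebra \<Rightarrow> 'a) \<Rightarrow> bool" where
  "derivation d \<longleftrightarrow>
     (\<forall>a b. d (a + b) = d a + d b) \<and>
     (\<forall>z a. d (scaleC z a) = scaleC z (d a)) \<and>
     (\<forall>a b. d (a * b) = d a * b + a * d b)"

definition hermitian_derivation :: "('a::complex_star_algebra \<Rightarrow> 'a) \<Rightarrow> bool" where
  "hermitian_derivation d \<longleftrightarrow> derivation d \<and> (\<forall>a. d (star a) = star (d a))"

definition star_algebra_hom ::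
    "('a::complex_star_algebra \<Rightarrow> 'b::complex_star_algebra) \<Rightarrow> bool" where
  "star_algebra_hom \<phi> \<longleftrightarrow>
     (\<forall>a b. \<phi> (a + b) = \<phi> a + \<phi> b) \<and>
     (\<forall>z a. \<phi> (scaleC z a) = scaleC z (\<phi> a)) \<and>
     (\<forall>a b. \<phi> (a * b) = \<phi> a * \<phi> b) \<and>
     \<phi> 1 = 1 \<and>
     (\<forall>a. \<phi> (star a) = star (\<phi> a))"

section \<open>Real Lie algebras\<close>

class real_lie_algebra = real_vector +
  fixes lie_bracket :: "'a \<Rightarrow> 'a \<Rightarrow> 'a"
  assumes lie_add_left: "lie_bracket (x + y) z = lie_bracket x z + lie_bracket y z"
    and lie_add_right: "lie_bracket x (y + z) = lie_bracket x y + lie_bracket x z"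
    and lie_scaleR_left: "lie_bracket (r *\<^sub>R x) y = r *\<^sub>R lie_bracket x y"
    and lie_scaleR_right: "lie_bracket x (r *\<^sub>R y) = r *\<^sub>R lie_bracket x y"
    and lie_self: "lie_bracket x x = 0"
    and lie_jacobi: "lie_bracket x (lie_bracket y z) + lie_bracket y (lie_bracket z x)
                       + lie_bracket z (lie_bracket x y) = 0"

definition lie_algebra_hom ::
    "('g::real_lie_algebra \<Rightarrow> 'h::real_lie_algebra) \<Rightarrow> bool" where
  "lie_algebra_hom \<psi> \<longleftrightarrow>
     linear \<psi> \<and> (\<forall>x y. \<psi> (lie_bracket x y) = lie_bracket (\<psi> x) (\<psi> y))"

definition faithful_hermitian_rep ::
    "('g::real_lie_algebra \<Rightarrow> 'a::complex_star_algebra \<Rightarrow> 'a) \<Rightarrow> bool" where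
  "faithful_hermitian_rep D \<longleftrightarrow>
     (\<forall>x. hermitian_derivation (D x)) \<and>
     (\<forall>x y a. D (x + y) a = D x a + D y a) \<and>
     (\<forall>r x a. D (r *\<^sub>R x) a = scaleC (complex_of_real r) (D x a)) \<and>
     (\<forall>x y a. D (lie_bracket x y) a = D x (D y a) - D y (D x a)) \<and>
     inj D"

section \<open>Right modules\<close>

text \<open>
  The addition of a module is that of the ambient group type; \<open>mcarrier\<close> is a subgroup of it, and
  \<open>mact M m a\<close> is the product \<open>m a\<close>, which is meaningful only for \<open>m\<close> in the carrier. All maps
  out of a module are total functions of which only the values on the carrier matter.
\<close>

record ('a, 'm) rmodule =
  mcarrier :: "'m set"
  mact :: "'m \<Rightarrow> 'a \<Rightarrow> 'm"

locale right_module =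
  fixes M :: "('a::complex_star_algebra, 'm::ab_group_add) rmodule"
  assumes zero_closed: "0 \<in> mcarrier M"
    and add_closed: "m \<in> mcarrier M \<Longrightarrow> m' \<in> mcarrier M \<Longrightarrow> m + m' \<in> mcarrier M"
    and uminus_closed: "m \<in> mcarrier M \<Longrightarrow> - m \<in> mcarrier M"
    and act_closed: "m \<in> mcarrier M \<Longrightarrow> mact M m a \<in> mcarrier M"
    and act_add_left: "m \<in> mcarrier M \<Longrightarrow> m' \<in> mcarrier M \<Longrightarrow>
                         mact M (m + m') a = mact M m a + mact M m' a"
    and act_add_right: "m \<in> mcarrier M \<Longrightarrow> mact M m (a + b) = mact M m a + mact M m b"
    and act_mult: "m \<in> mcarrier M \<Longrightarrow> mact M m (a * b) = mact M (mact M m a) b"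
    and act_one: "m \<in> mcarrier M \<Longrightarrow> mact M m 1 = m"

definition submodule :: "'m set \<Rightarrow> ('a::complex_star_algebra, 'm::ab_group_add) rmodule \<Rightarrow> bool" where
  "submodule N M \<longleftrightarrow> N \<subseteq> mcarrier M \<and> right_module (M\<lparr>mcarrier := N\<rparr>)"

definition generated_submodule ::
    "('a::complex_star_algebra, 'm::ab_group_add) rmodule \<Rightarrow> 'm set \<Rightarrow> 'm set" where
  "generated_submodule M S = \<Inter>{N. submodule N M \<and> S \<subseteq> N}"

definition module_hom ::
    "('a::complex_star_algebra, 'm::ab_group_add) rmodule \<Rightarrow> ('a, 'n::ab_group_add) rmodule
       \<Rightarrow> ('m \<Rightarrow> 'n) \<Rightarrow> bool" where
  "module_hom M N f \<longleftrightarrow>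
     f ` mcarrier M \<subseteq> mcarrier N \<and>
     (\<forall>m\<in>mcarrier M. \<forall>m'\<in>mcarrier M. f (m + m') = f m + f m') \<and>
     (\<forall>m\<in>mcarrier M. \<forall>a. f (mact M m a) = mact N (f m) a)"

text \<open>
  Projectivity is the lifting property along surjections. A quantifier in a definition cannot range
  over types, so the test modules are taken over two fixed types that depend only on those of
  \<open>M\<close>. This loses nothing: lemma \<open>projective_module_lift\<close> below derives the lifting property
  for test modules over arbitrary types.
\<close>

definition projective_module :: "('a::complex_star_algebra, 'm::ab_group_add) rmodule \<Rightarrow> bool" where
  "projective_module M \<longleftrightarrow> right_module M \<and>
     (\<forall>(N :: ('a, 'm \<Rightarrow> 'a) rmodule) (L :: ('a, 'm) rmodule) q f.
        right_module N \<longrightarrow> right_module L \<longrightarrow>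
        module_hom N L q \<longrightarrow> q ` mcarrier N = mcarrier L \<longrightarrow> module_hom M L f \<longrightarrow>
        (\<exists>h. module_hom M N h \<and> (\<forall>m\<in>mcarrier M. q (h m) = f m)))"

text \<open>The free module \<open>A^n\<close>: sequences vanishing from index \<open>n\<close> on.\<close>

definition free_rmodule :: "nat \<Rightarrow> ('a::complex_star_algebra, nat \<Rightarrow> 'a) rmodule" where
  "free_rmodule n = \<lparr>mcarrier = {v. \<forall>i\<ge>n. v i = 0}, mact = (\<lambda>v a i. v i * a)\<rparr>"

definition projection :: "nat \<Rightarrow> ((nat \<Rightarrow> 'a::complex_star_algebra) \<Rightarrow> nat \<Rightarrow> 'a) \<Rightarrow> bool" where
  "projection n P \<longleftrightarrow>
     module_hom (free_rmodule n) (free_rmodule n) P \<and>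
     (\<forall>v\<in>mcarrier (free_rmodule n). P (P v) = P v)"

definition projection_range ::
    "nat \<Rightarrow> ((nat \<Rightarrow> 'a::complex_star_algebra) \<Rightarrow> nat \<Rightarrow> 'a) \<Rightarrow> ('a, nat \<Rightarrow> 'a) rmodule" where
  "projection_range n P = (free_rmodule n)\<lparr>mcarrier := P ` mcarrier (free_rmodule n)\<rparr>"

text \<open>
  The scalar multiplication by a real number \<open>r\<close> on a right \<open>A\<close>-module is the action of \<open>r 1\<close>.
\<close>

definition real_linear_into ::
    "('a::complex_star_algebra, 'm::ab_group_add) rmodule \<Rightarrow> ('g::real_vector \<Rightarrow> 'm) \<Rightarrow> bool" where
  "real_linear_into M f \<longleftrightarrow>
     range f \<subseteq> mcarrier M \<and>
     (\<forall>x y. f (x + y) = f x + f y) \<and>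
     (\<forall>r x. f (r *\<^sub>R x) = mact M (f x) (scaleC (complex_of_real r) 1))"

section \<open>Real calculi\<close>

text \<open>The algebra \<open>A\<close> and the Lie algebra \<open>g\<close> are given by the types \<open>'a\<close> and \<open>'g\<close>.\<close>

record ('a, 'g, 'm) calculus =
  crep :: "'g \<Rightarrow> 'a \<Rightarrow> 'a"
  cmodule :: "('a, 'm) rmodule"
  cmap :: "'g \<Rightarrow> 'm"

locale real_calculus =
  fixes C :: "('a::complex_star_algebra, 'g::real_lie_algebra, 'm::ab_group_add) calculus"
  assumes rep: "faithful_hermitian_rep (crep C)"
    and module: "right_module (cmodule C)"
    and map_linear: "real_linear_into (cmodule C) (cmap C)"
    and map_generates: "generated_submodule (cmodule C) (range (cmap C)) = mcarrier (cmodule C)"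

definition projective_real_calculus ::
    "('a::complex_star_algebra, 'g::real_lie_algebra, 'm::ab_group_add) calculus \<Rightarrow> bool" where
  "projective_real_calculus C \<longleftrightarrow> real_calculus C \<and> projective_module (cmodule C)"

text \<open>The submodule \<open>M_\<Psi>\<close> generated by the range of \<open>\<Psi> = \<phi> \<circ> \<psi>\<close>.\<close>

definition psi_submodule ::
    "('a::complex_star_algebra, 'g::real_lie_algebra, 'm::ab_group_add) calculus
       \<Rightarrow> ('h \<Rightarrow> 'g) \<Rightarrow> 'm set" where
  "psi_submodule C \<psi> = generated_submodule (cmodule C) (range (cmap C \<circ> \<psi>))"

definition real_calculus_hom ::
    "('a::complex_star_algebra, 'g::real_lie_algebra, 'm::ab_group_add) calculus
       \<Rightarrow> ('b::complex_star_algebra, 'h::real_lie_algebra, 'n::ab_group_add) calculus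
       \<Rightarrow> ('a \<Rightarrow> 'b) \<Rightarrow> ('h \<Rightarrow> 'g) \<Rightarrow> ('m \<Rightarrow> 'n) \<Rightarrow> bool" where
  "real_calculus_hom C C' \<phi> \<psi> \<psi>h \<longleftrightarrow>
     star_algebra_hom \<phi> \<and>
     lie_algebra_hom \<psi> \<and>
     (\<forall>\<delta> a. \<phi> (crep C (\<psi> \<delta>) a) = crep C' \<delta> (\<phi> a)) \<and>
     \<psi>h ` psi_submodule C \<psi> \<subseteq> mcarrier (cmodule C') \<and>
     (\<forall>m\<in>psi_submodule C \<psi>. \<forall>m'\<in>psi_submodule C \<psi>. \<psi>h (m + m') = \<psi>h m + \<psi>h m') \<and>
     (\<forall>m\<in>psi_submodule C \<psi>. \<forall>a. \<psi>h (mact (cmodule C) m a) = mact (cmodule C') (\<psi>h m) (\<phi> a)) \<and>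
     (\<forall>\<delta>. \<psi>h (cmap C (\<psi> \<delta>)) = cmap C' \<delta>)"

definition real_calculus_iso ::
    "('a::complex_star_algebra, 'g::real_lie_algebra, 'm::ab_group_add) calculus
       \<Rightarrow> ('b::complex_star_algebra, 'h::real_lie_algebra, 'n::ab_group_add) calculus
       \<Rightarrow> ('a \<Rightarrow> 'b) \<Rightarrow> ('h \<Rightarrow> 'g) \<Rightarrow> ('m \<Rightarrow> 'n) \<Rightarrow> bool" where
  "real_calculus_iso C C' \<phi> \<psi> \<psi>h \<longleftrightarrow>
     real_calculus_hom C C' \<phi> \<psi> \<psi>h \<and> bij \<phi> \<and> bij \<psi> \<and>
     bij_betw \<psi>h (psi_submodule C \<psi>) (mcarrier (cmodule C'))"

definition real_calculi_isomorphic ::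
    "('a::complex_star_algebra, 'g::real_lie_algebra, 'm::ab_group_add) calculus
       \<Rightarrow> ('b::complex_star_algebra, 'h::real_lie_algebra, 'n::ab_group_add) calculus
       \<Rightarrow> bool" (infix "\<simeq>" 50) where
  "C \<simeq> C' \<longleftrightarrow> (\<exists>\<phi> \<psi> \<psi>h. real_calculus_iso C C' \<phi> \<psi> \<psi>h)"

section \<open>Projectivity does not depend on the types of the test modules\<close>

definition finsupp_module :: "'m set \<Rightarrow> ('a::complex_star_algebra, 'm \<Rightarrow> 'a) rmodule" where
  "finsupp_module X =
     \<lparr>mcarrier = {u. finite {x. u x \<noteq> 0} \<and> {x. u x \<noteq> 0} \<subseteq> X}, mact = (\<lambda>u a x. u x * a)\<rparr>"

lemma right_module_finsupp:
  "right_module (finsupp_module X :: ('a::complex_star_algebra, 'm \<Rightarrow> 'a) rmodule)"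
proof
  fix u v :: "'m \<Rightarrow> 'a" and a :: 'a
  assume u: "u \<in> mcarrier (finsupp_module X)"
  have "{x. u x * a \<noteq> 0} \<subseteq> {x. u x \<noteq> 0}" by auto
  then show "mact (finsupp_module X) u a \<in> mcarrier (finsupp_module X)"
    using u by (auto simp: finsupp_module_def intro: finite_subset)
  assume v: "v \<in> mcarrier (finsupp_module X)"
  have s: "{x. (u + v) x \<noteq> 0} \<subseteq> {x. u x \<noteq> 0} \<union> {x. v x \<noteq> 0}" by auto
  have "finite ({x. u x \<noteq> 0} \<union> {x. v x \<noteq> 0})"
    using u v by (simp add: finsupp_module_def)
  from finite_subset[OF s this] s show "u + v \<in> mcarrier (finsupp_module X)"
    using u v unfolding finsupp_module_def by auto
qed (auto simp: finsupp_module_def fun_eq_iff algebra_simps)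

context right_module
begin

lemma act_zero_left: "mact M 0 a = 0"
  using act_add_left[of 0 0 a] zero_closed by simp

lemma act_zero_right: "m \<in> mcarrier M \<Longrightarrow> mact M m 0 = 0"
  using act_add_right[of m 0 0] by simp

lemma sum_closed: "(\<And>x. x \<in> S \<Longrightarrow> f x \<in> mcarrier M) \<Longrightarrow> sum f S \<in> mcarrier M"
  by (induction S rule: infinite_finite_induct) (auto intro: zero_closed add_closed)

lemma act_sum: "(\<And>x. x \<in> S \<Longrightarrow> f x \<in> mcarrier M) \<Longrightarrow> mact M (sum f S) a = (\<Sum>x\<in>S. mact M (f x) a)"
  by (induction S rule: infinite_finite_induct)
    (auto simp: act_zero_left act_add_left sum_closed)

end

definition lincomb :: "('a::complex_star_algebra, 'n::ab_group_add) rmodule \<Rightarrow> ('m \<Rightarrow> 'n) \<Rightarrow> ('m \<Rightarrow> 'a) \<Rightarrow> 'n"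
  where "lincomb N y u = (\<Sum>x | u x \<noteq> 0. mact N (y x) (u x))"

lemma lincomb_superset:
  assumes "right_module N" "\<And>x. x \<in> X \<Longrightarrow> y x \<in> mcarrier N"
    and "finite T" "{x. u x \<noteq> 0} \<subseteq> T" "T \<subseteq> X"
  shows "lincomb N y u = (\<Sum>x\<in>T. mact N (y x) (u x))"
  unfolding lincomb_def using assms
  by (intro sum.mono_neutral_left) (auto simp: right_module.act_zero_right)

lemma module_hom_lincomb:
  fixes N :: "('a::complex_star_algebra, 'n::ab_group_add) rmodule" and X :: "'m set"
  assumes N: "right_module N" and y: "\<And>x. x \<in> X \<Longrightarrow> y x \<in> mcarrier N"
  shows "module_hom (finsupp_module X) N (lincomb N y)"
  unfolding module_hom_def
proof (intro conjI ballI allI image_subsetI)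
  interpret N: right_module N by (fact N)
  fix u :: "'m \<Rightarrow> 'a" assume u: "u \<in> mcarrier (finsupp_module X)"
  let ?U = "{x. u x \<noteq> 0}"
  have U: "finite ?U" "?U \<subseteq> X" using u by (auto simp: finsupp_module_def)
  show "lincomb N y u \<in> mcarrier N"
    unfolding lincomb_def using U(2) y by (intro N.sum_closed N.act_closed) auto
  {
    fix a
    have "lincomb N y (mact (finsupp_module X) u a)
        = (\<Sum>x\<in>?U. mact N (y x) (u x * a))"
      by (subst lincomb_superset[OF N y U(1) _ U(2)]) (auto simp: finsupp_module_def)
    also have "\<dots> = (\<Sum>x\<in>?U. mact N (mact N (y x) (u x)) a)"
      using U(2) y by (intro sum.cong refl N.act_mult) auto
    also have "\<dots> = mact N (lincomb N y u) a"
      unfolding lincomb_def using U(2) y by (intro N.act_sum[symmetric] N.act_closed) auto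
    finally show "lincomb N y (mact (finsupp_module X) u a) = mact N (lincomb N y u) a" .
  }
  fix v :: "'m \<Rightarrow> 'a" assume v: "v \<in> mcarrier (finsupp_module X)"
  let ?T = "?U \<union> {x. v x \<noteq> 0}"
  have T: "finite ?T" "?T \<subseteq> X" using u v by (auto simp: finsupp_module_def)
  have "lincomb N y (u + v) = (\<Sum>x\<in>?T. mact N (y x) (u x + v x))"
    by (subst lincomb_superset[OF N y T(1) _ T(2)]) auto
  also have "\<dots> = (\<Sum>x\<in>?T. mact N (y x) (u x) + mact N (y x) (v x))"
    using T(2) y by (intro sum.cong refl N.act_add_right) auto
  also have "\<dots> = lincomb N y u + lincomb N y v"
    unfolding sum.distrib
    by (subst (1 2) lincomb_superset[OF N y T(1) _ T(2)]) auto
  finally show "lincomb N y (u + v) = lincomb N y u + lincomb N y v" .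
qed

lemma module_hom_sum:
  assumes "right_module M" "right_module N" "module_hom M N q" "\<And>x. x \<in> S \<Longrightarrow> f x \<in> mcarrier M"
  shows "q (sum f S) = (\<Sum>x\<in>S. q (f x))"
proof -
  interpret M: right_module M by fact
  interpret N: right_module N by fact
  have "q 0 = q 0 + q 0"
    using assms(3) M.zero_closed unfolding module_hom_def by (metis add_0)
  then have z: "q 0 = 0" by simp
  show ?thesis using assms(4)
    using assms(3) by (induction S rule: infinite_finite_induct)
      (auto simp: z module_hom_def M.sum_closed)
qed

lemma projective_module_lift:
  fixes M :: "('a::complex_star_algebra, 'm::ab_group_add) rmodule"
    and N :: "('a, 'n::ab_group_add) rmodule" and L :: "('a, 'l::ab_group_add) rmodule"
  assumes M: "projective_module M" and N: "right_module N" and L: "right_module L"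
    and q: "module_hom N L q" "q ` mcarrier N = mcarrier L" and f: "module_hom M L f"
  obtains h where "module_hom M N h" "\<And>m. m \<in> mcarrier M \<Longrightarrow> q (h m) = f m"
proof -
  let ?X = "mcarrier M" and ?F = "finsupp_module (mcarrier M) :: ('a, 'm \<Rightarrow> 'a) rmodule"
  have M': "right_module M" using M by (simp add: projective_module_def)
  interpret M: right_module M by (fact M')
  let ?p = "lincomb M (\<lambda>x. x)"
  have p: "module_hom ?F M ?p" by (rule module_hom_lincomb[OF M'])
  have "?p ` mcarrier ?F = mcarrier M"
  proof
    show "?p ` mcarrier ?F \<subseteq> mcarrier M" using p by (simp add: module_hom_def)
    show "mcarrier M \<subseteq> ?p ` mcarrier ?F"
    proof
      fix m assume m: "m \<in> mcarrier M"
      let ?d = "\<lambda>x. if x = m then 1 else (0::'a)"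
      have s: "{x. ?d x \<noteq> 0} \<subseteq> {m}" by auto
      have "?d \<in> mcarrier ?F"
        using m finite_subset[OF s] s by (auto simp: finsupp_module_def)
      moreover have "?p ?d = m"
        using m by (subst lincomb_superset[OF M', of ?X _ "{m}"]) (auto simp: M.act_one)
      ultimately show "m \<in> ?p ` mcarrier ?F" by force
    qed
  qed
  moreover have "module_hom M M (\<lambda>m. m)" by (auto simp: module_hom_def)
  ultimately obtain s where s: "module_hom M ?F s" "\<And>m. m \<in> mcarrier M \<Longrightarrow> ?p (s m) = m"
    using M p right_module_finsupp M' unfolding projective_module_def by metis
  have "\<forall>x\<in>?X. \<exists>y\<in>mcarrier N. q y = f x"
    using f q(2) unfolding module_hom_def by (metis image_iff image_subset_iff)
  then obtain y where y: "\<And>x. x \<in> ?X \<Longrightarrow> y x \<in> mcarrier N" "\<And>x. x \<in> ?X \<Longrightarrow> q (y x) = f x"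
    by metis
  have t: "module_hom ?F N (lincomb N y)" by (rule module_hom_lincomb[OF N y(1)])
  have eq: "q (lincomb N y u) = f (?p u)" if u: "u \<in> mcarrier ?F" for u
  proof -
    let ?U = "{x. u x \<noteq> 0}"
    have U: "x \<in> ?X" if "x \<in> ?U" for x using u that by (auto simp: finsupp_module_def)
    have "q (lincomb N y u) = (\<Sum>x\<in>?U. q (mact N (y x) (u x)))"
      unfolding lincomb_def
      by (rule module_hom_sum[OF N L q(1)]) (use U y N in \<open>auto intro: right_module.act_closed\<close>)
    also have "\<dots> = (\<Sum>x\<in>?U. f (mact M x (u x)))"
      using U y q(1) f by (intro sum.cong refl) (auto simp: module_hom_def)
    also have "\<dots> = f (?p u)"
      unfolding lincomb_def
      by (rule module_hom_sum[OF M' L f, symmetric]) (use U in \<open>auto intro: M.act_closed\<close>)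
    finally show ?thesis .
  qed
  show ?thesis
  proof
    show "module_hom M N (lincomb N y \<circ> s)"
      using s(1) t by (auto simp: module_hom_def image_subset_iff)
    show "q ((lincomb N y \<circ> s) m) = f m" if "m \<in> mcarrier M" for m
      using eq[of "s m"] s that by (auto simp: module_hom_def)
  qed
qed

end

theory Submission
  imports Defs
begin

text \<open>
  A basis \<open>e 0, \<dots>, e (n - 1)\<close> of the Lie algebra gives two maps: the module homomorphism
  \<open>q : A^n \<rightarrow> M\<close> that sends the \<open>i\<close>-th standard vector to \<open>\<phi> (e i)\<close>, and the real-linear map
  \<open>\<phi>t : g \<rightarrow> A^n\<close> that sends \<open>x\<close> to its real coordinates, read as multiples of \<open>1\<close>. They are made
  so that \<open>q \<circ> \<phi>t = \<phi>\<close> (lemma \<open>lincomb_coordinates\<close>). Hence the image of \<open>q\<close> is a submodule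
  containing \<open>\<phi> g\<close>, and \<open>q\<close> is surjective because \<open>\<phi> g\<close> generates \<open>M\<close>.

  As \<open>M\<close> is projective, \<open>q\<close> has a section \<open>h\<close>, and \<open>P = h \<circ> q\<close> is a projection whose range
  \<open>h M\<close> is a copy of \<open>M\<close>: \<open>h\<close> and the restriction of \<open>q\<close> are inverse to each other. Under this
  identification \<open>P \<circ> \<phi>t = h \<circ> \<phi>\<close> corresponds to \<open>\<phi>\<close>, so it generates the range
  (lemma \<open>generates_image\<close>), and \<open>(id, id, q)\<close> is the required isomorphism.
\<close>

section \<open>Homomorphisms and generated submodules\<close>

lemma module_homD:
  assumes "module_hom M N f" "m \<in> mcarrier M"
  shows "f m \<in> mcarrier N" "m' \<in> mcarrier M \<Longrightarrow> f (m + m') = f m + f m'"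
    "f (mact M m a) = mact N (f m) a"
  using assms by (auto simp: module_hom_def)

lemma module_hom_zero:
  assumes "right_module M" "module_hom M N f"
  shows "f 0 = 0"
proof -
  have "0 \<in> mcarrier M" by (rule right_module.zero_closed[OF assms(1)])
  from module_homD(2)[OF assms(2) this this] show ?thesis by simp
qed

lemma module_hom_uminus:
  assumes "right_module M" "module_hom M N f" "m \<in> mcarrier M"
  shows "f (- m) = - f m"
proof -
  have "- m \<in> mcarrier M" by (rule right_module.uminus_closed[OF assms(1,3)])
  from module_homD(2)[OF assms(2,3) this] show ?thesis
    using module_hom_zero[OF assms(1,2)] by (simp add: minus_unique)
qed

lemma submoduleI:
  assumes M: "right_module M" and sub: "K \<subseteq> mcarrier M"
    and "0 \<in> K" "\<And>m m'. m \<in> K \<Longrightarrow> m' \<in> K \<Longrightarrow> m + m' \<in> K" "\<And>m. m \<in> K \<Longrightarrow> - m \<in> K"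
    and "\<And>m a. m \<in> K \<Longrightarrow> mact M m a \<in> K"
  shows "submodule K M"
proof -
  interpret M: right_module M by (fact M)
  have "right_module (M\<lparr>mcarrier := K\<rparr>)"
  proof
    fix m m' a b
    assume m: "m \<in> mcarrier (M\<lparr>mcarrier := K\<rparr>)"
    then have mM: "m \<in> mcarrier M" using sub by auto
    show "- m \<in> mcarrier (M\<lparr>mcarrier := K\<rparr>)"
      "mact (M\<lparr>mcarrier := K\<rparr>) m a \<in> mcarrier (M\<lparr>mcarrier := K\<rparr>)"
      using m assms by simp_all
    show "mact (M\<lparr>mcarrier := K\<rparr>) m (a + b)
        = mact (M\<lparr>mcarrier := K\<rparr>) m a + mact (M\<lparr>mcarrier := K\<rparr>) m b"
      "mact (M\<lparr>mcarrier := K\<rparr>) m (a * b)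
        = mact (M\<lparr>mcarrier := K\<rparr>) (mact (M\<lparr>mcarrier := K\<rparr>) m a) b"
      "mact (M\<lparr>mcarrier := K\<rparr>) m 1 = m"
      using mM by (simp_all add: M.act_add_right M.act_mult M.act_one)
    assume m': "m' \<in> mcarrier (M\<lparr>mcarrier := K\<rparr>)"
    show "m + m' \<in> mcarrier (M\<lparr>mcarrier := K\<rparr>)" using m m' assms by simp
    have "m' \<in> mcarrier M" using m' sub by auto
    then show "mact (M\<lparr>mcarrier := K\<rparr>) (m + m') a
        = mact (M\<lparr>mcarrier := K\<rparr>) m a + mact (M\<lparr>mcarrier := K\<rparr>) m' a"
      using mM by (simp add: M.act_add_left)
  qed (use assms in simp)
  then show ?thesis using sub by (simp add: submodule_def)
qed

lemma submoduleD:
  assumes "submodule K M"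
  shows "K \<subseteq> mcarrier M" "0 \<in> K" "m \<in> K \<Longrightarrow> m' \<in> K \<Longrightarrow> m + m' \<in> K" "m \<in> K \<Longrightarrow> - m \<in> K"
    "m \<in> K \<Longrightarrow> mact M m a \<in> K"
proof -
  show "K \<subseteq> mcarrier M" using assms by (simp add: submodule_def)
  interpret K: right_module "M\<lparr>mcarrier := K\<rparr>"
    using assms by (simp add: submodule_def)
  show "0 \<in> K" "m \<in> K \<Longrightarrow> m' \<in> K \<Longrightarrow> m + m' \<in> K" "m \<in> K \<Longrightarrow> - m \<in> K"
    "m \<in> K \<Longrightarrow> mact M m a \<in> K"
    using K.zero_closed K.add_closed K.uminus_closed K.act_closed by auto
qed

lemma submodule_image:
  assumes M: "right_module M" and N: "right_module N" and f: "module_hom M N f"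
  shows "submodule (f ` mcarrier M) N"
proof (rule submoduleI[OF N])
  interpret M: right_module M by (fact M)
  show "f ` mcarrier M \<subseteq> mcarrier N" using f by (simp add: module_hom_def)
  show "0 \<in> f ` mcarrier M"
    using module_hom_zero[OF M f] M.zero_closed by (metis imageI)
  fix y a assume "y \<in> f ` mcarrier M"
  then obtain m where m: "m \<in> mcarrier M" and y: "y = f m" by blast
  show "- y \<in> f ` mcarrier M"
    using module_hom_uminus[OF M f m] M.uminus_closed[OF m] y by (metis imageI)
  show "mact N y a \<in> f ` mcarrier M"
    using module_homD(3)[OF f m] M.act_closed[OF m] y by (metis imageI)
  fix y' assume "y' \<in> f ` mcarrier M"
  then obtain m' where m': "m' \<in> mcarrier M" and y': "y' = f m'" by blast
  show "y + y' \<in> f ` mcarrier M"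
    using module_homD(2)[OF f m m'] M.add_closed[OF m m'] y y' by (metis imageI)
qed

lemma submodule_vimage:
  assumes M: "right_module M" and f: "module_hom M N f" and K: "submodule K N"
  shows "submodule {m \<in> mcarrier M. f m \<in> K} M"
proof -
  interpret M: right_module M by (fact M)
  show ?thesis
  proof (rule submoduleI[OF M])
    show "0 \<in> {m \<in> mcarrier M. f m \<in> K}"
      using M.zero_closed submoduleD(2)[OF K] by (simp add: module_hom_zero[OF M f])
    fix m a assume "m \<in> {m \<in> mcarrier M. f m \<in> K}"
    then have m: "m \<in> mcarrier M" "f m \<in> K" by simp_all
    show "- m \<in> {m \<in> mcarrier M. f m \<in> K}"
      using M.uminus_closed[OF m(1)] module_hom_uminus[OF M f m(1)] submoduleD(4)[OF K m(2)]
      by simp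
    show "mact M m a \<in> {m \<in> mcarrier M. f m \<in> K}"
      using M.act_closed[OF m(1)] module_homD(3)[OF f m(1)] submoduleD(5)[OF K m(2)] by simp
    fix m' assume "m' \<in> {m \<in> mcarrier M. f m \<in> K}"
    then have m': "m' \<in> mcarrier M" "f m' \<in> K" by simp_all
    show "m + m' \<in> {m \<in> mcarrier M. f m \<in> K}"
      using M.add_closed[OF m(1) m'(1)] module_homD(2)[OF f m(1) m'(1)]
        submoduleD(3)[OF K m(2) m'(2)] by simp
  qed simp
qed

lemma submodule_self: "right_module M \<Longrightarrow> submodule (mcarrier M) M"
  by (simp add: submodule_def)

lemma generated_submodule_least:
  "submodule K M \<Longrightarrow> S \<subseteq> K \<Longrightarrow> generated_submodule M S \<subseteq> K"
  unfolding generated_submodule_def by blast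

text \<open>
  A submodule \<open>K\<close> containing \<open>f ` S\<close> is everything: its preimage is a submodule containing \<open>S\<close>.
\<close>

lemma generates_image:
  assumes M: "right_module M" and N: "right_module N"
    and f: "module_hom M N f" and onto: "f ` mcarrier M = mcarrier N"
    and S: "S \<subseteq> mcarrier M" and gen: "generated_submodule M S = mcarrier M"
  shows "generated_submodule N (f ` S) = mcarrier N"
proof
  show "generated_submodule N (f ` S) \<subseteq> mcarrier N"
    by (rule generated_submodule_least[OF submodule_self[OF N]]) (use image_mono[OF S, of f] in \<open>simp only: onto\<close>)
  show "mcarrier N \<subseteq> generated_submodule N (f ` S)"
    unfolding generated_submodule_def
  proof (rule Inter_greatest, clarify)
    fix K y
    assume K: "submodule K N" and fS: "f ` S \<subseteq> K" and y: "y \<in> mcarrier N"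
    have "S \<subseteq> {m \<in> mcarrier M. f m \<in> K}" using S fS by auto
    from generated_submodule_least[OF submodule_vimage[OF M f K] this]
    have "mcarrier M \<subseteq> {m \<in> mcarrier M. f m \<in> K}" by (simp only: gen)
    moreover obtain m where "m \<in> mcarrier M" "y = f m"
      using y unfolding onto[symmetric] by (rule imageE)
    ultimately show "y \<in> K" by auto
  qed
qed

section \<open>Free modules and projections\<close>

text \<open>
  Through this identification the linear-combination homomorphisms out of \<^const>\<open>finsupp_module\<close>
  become homomorphisms out of \<open>A^n\<close>.
\<close>

lemma free_rmodule_eq_finsupp: "free_rmodule n = finsupp_module {..<n}"
proof -
  have "{v :: nat \<Rightarrow> 'a. \<forall>i\<ge>n. v i = 0} = {u. finite {x. u x \<noteq> 0} \<and> {x. u x \<noteq> 0} \<subseteq> {..<n}}"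
  proof (intro Collect_cong)
    fix v :: "nat \<Rightarrow> 'a"
    have "(\<forall>i\<ge>n. v i = 0) \<longleftrightarrow> {x. v x \<noteq> 0} \<subseteq> {..<n}"
      unfolding subset_iff mem_Collect_eq lessThan_iff by (metis not_less)
    then show "(\<forall>i\<ge>n. v i = 0) \<longleftrightarrow> finite {x. v x \<noteq> 0} \<and> {x. v x \<noteq> 0} \<subseteq> {..<n}"
      using finite_subset[OF _ finite_lessThan] by blast
  qed
  then show ?thesis by (simp add: free_rmodule_def finsupp_module_def)
qed

lemma right_module_free: "right_module (free_rmodule n)"
  unfolding free_rmodule_eq_finsupp by (rule right_module_finsupp)

lemma right_module_projection_range:
  assumes "projection n P"
  shows "right_module (projection_range n P)"
  using submodule_image[OF right_module_free right_module_free] assms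
  unfolding projection_def projection_range_def submodule_def by blast

lemma module_hom_comp:
  "module_hom M N f \<Longrightarrow> module_hom N L g \<Longrightarrow> module_hom M L (g \<circ> f)"
  by (auto simp: module_hom_def image_subset_iff)

section \<open>Real-linear maps and coordinates\<close>

lemma real_linear_into_sum:
  assumes M: "right_module M" and f: "real_linear_into M f"
  shows "f (\<Sum>i\<in>I. r i *\<^sub>R b i) = (\<Sum>i\<in>I. mact M (f (b i)) (scaleC (complex_of_real (r i)) 1))"
proof -
  have add: "f (x + y) = f x + f y" for x y
    using f by (simp add: real_linear_into_def)
  have "f 0 = 0" using add[of 0 0] by simp
  then show ?thesis
    using f by (induction I rule: infinite_finite_induct) (auto simp: add real_linear_into_def)
qed

lemma real_linear_into_comp:
  assumes "real_linear_into M f" "module_hom M N g"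
  shows "real_linear_into N (g \<circ> f)"
proof -
  have "f x \<in> mcarrier M" for x using assms(1) by (auto simp: real_linear_into_def)
  then show ?thesis using assms by (auto simp: real_linear_into_def module_hom_def)
qed

text \<open>
  The real coordinates are stored as real multiples of \<open>1\<close>, because the scalar product of a module
  element with a real number is its product with such a multiple.
\<close>

definition coordinates ::
    "nat \<Rightarrow> (nat \<Rightarrow> 'g::real_vector) \<Rightarrow> 'g \<Rightarrow> nat \<Rightarrow> 'a::complex_star_algebra" where
  "coordinates n e x i =
     (if i < n then scaleC (complex_of_real (representation (e ` {..<n}) x (e i))) 1 else 0)"

lemma real_linear_coordinates:
  assumes indep: "independent (e ` {..<n})" and span: "span (e ` {..<n}) = UNIV"
  shows "real_linear_into (free_rmodule n)
    (coordinates n e :: 'g::real_vector \<Rightarrow> nat \<Rightarrow> 'a::complex_star_algebra)"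
  unfolding real_linear_into_def
proof (intro conjI allI)
  show "range (coordinates n e :: 'g \<Rightarrow> nat \<Rightarrow> 'a) \<subseteq> mcarrier (free_rmodule n)"
    by (auto simp: coordinates_def free_rmodule_def)
  show "(coordinates n e (x + y) :: nat \<Rightarrow> 'a) = coordinates n e x + coordinates n e y" for x y
    using span
    by (auto simp: coordinates_def fun_eq_iff real_vector.representation_add[OF indep]
        scaleC_add_left)
  show "(coordinates n e (r *\<^sub>R x) :: nat \<Rightarrow> 'a)
    = mact (free_rmodule n) (coordinates n e x) (scaleC (complex_of_real r) 1)" for r x
    using span
    by (auto simp: coordinates_def free_rmodule_def fun_eq_iff
        real_vector.representation_scale[OF indep] scaleC_mult_left scaleC_scaleC mult.commute)
qed

lemma lincomb_coordinates:
  fixes M :: "('a::complex_star_algebra, 'm::ab_group_add) rmodule" and e :: "nat \<Rightarrow> 'g::real_vector"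
  assumes M: "right_module M" and f: "real_linear_into M f"
    and inj: "inj_on e {..<n}"
    and indep: "independent (e ` {..<n})" and span: "span (e ` {..<n}) = UNIV"
  shows "lincomb M (f \<circ> e) (coordinates n e x) = f x"
proof -
  let ?r = "\<lambda>i. representation (e ` {..<n}) x (e i)"
  have fx: "f y \<in> mcarrier M" for y using f by (auto simp: real_linear_into_def)
  have "x = (\<Sum>b\<in>e ` {..<n}. representation (e ` {..<n}) x b *\<^sub>R b)"
    using span by (subst real_vector.sum_representation_eq[OF indep]) auto
  also have "\<dots> = (\<Sum>i<n. ?r i *\<^sub>R e i)"
    using inj by (simp add: sum.reindex)
  finally have "f x = f (\<Sum>i<n. ?r i *\<^sub>R e i)" by simp
  also have "\<dots> = (\<Sum>i<n. mact M ((f \<circ> e) i) (coordinates n e x i))"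
    by (simp add: real_linear_into_sum[OF M f] coordinates_def)
  also have "\<dots> = lincomb M (f \<circ> e) (coordinates n e x)"
    by (rule lincomb_superset[OF M, of UNIV, symmetric])
      (auto simp: fx coordinates_def split: if_splits)
  finally show ?thesis ..
qed

lemma finite_dimensional_basis_enumeration:
  assumes "\<exists>B :: ('g::real_vector) set. finite B \<and> span B = UNIV"
    and "dim (UNIV :: ('g::real_vector) set) = n"
  shows "\<exists>e :: nat \<Rightarrow> 'g. inj_on e {..<n} \<and> independent (e ` {..<n}) \<and> span (e ` {..<n}) = UNIV"
proof -
  obtain T :: "'g set" where T: "finite T" "span T = UNIV" using assms(1) by blast
  obtain B :: "'g set" where B: "independent B" "UNIV \<subseteq> span B" "card B = n"
    using real_vector.basis_exists[of "UNIV :: 'g set"] assms(2) by metis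
  have "finite B"
    using real_vector.independent_span_bound[OF T(1) B(1)] T(2) by simp
  then obtain e where "bij_betw e {..<n} B"
    using ex_bij_betw_nat_finite[of B] B(3) by (auto simp: atLeast0LessThan)
  then show ?thesis
    using B by (intro exI[of _ e]) (auto simp: bij_betw_def)
qed

section \<open>Projective real calculi as ranges of projections\<close>

theorem proposition3p2:
  fixes C :: "('a::complex_star_algebra, 'g::real_lie_algebra, 'm::ab_group_add) calculus"
    and n :: nat
  assumes "projective_real_calculus C"
    and "\<exists>B :: 'g set. finite B \<and> span B = UNIV"
    and "dim (UNIV :: 'g set) = n"
  shows "\<exists>(\<phi>t :: 'g \<Rightarrow> nat \<Rightarrow> 'a) (P :: (nat \<Rightarrow> 'a) \<Rightarrow> nat \<Rightarrow> 'a).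
           real_linear_into (free_rmodule n) \<phi>t \<and> projection n P \<and>
           (let C' = \<lparr>crep = crep C, cmodule = projection_range n P, cmap = P \<circ> \<phi>t\<rparr>
            in real_calculus C' \<and> C' \<simeq> C)"
proof -
  let ?M = "cmodule C" and ?f = "cmap C" and ?F = "free_rmodule n :: ('a, nat \<Rightarrow> 'a) rmodule"
  interpret real_calculus C using assms(1) by (simp add: projective_real_calculus_def)
  have proj: "projective_module ?M" using assms(1) by (simp add: projective_real_calculus_def)
  have f_in: "?f x \<in> mcarrier ?M" for x using map_linear by (auto simp: real_linear_into_def)
  obtain e :: "nat \<Rightarrow> 'g" where e: "inj_on e {..<n}" "independent (e ` {..<n})"
      "span (e ` {..<n}) = UNIV"
    using finite_dimensional_basis_enumeration[OF assms(2,3)] by blast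
  define \<phi>t :: "'g \<Rightarrow> nat \<Rightarrow> 'a" where "\<phi>t = coordinates n e"
  define q where "q = lincomb ?M (?f \<circ> e)"
  have \<phi>t: "real_linear_into ?F \<phi>t"
    unfolding \<phi>t_def by (rule real_linear_coordinates[OF e(2,3)])
  have \<phi>t_in: "\<phi>t x \<in> mcarrier ?F" for x using \<phi>t by (auto simp: real_linear_into_def)
  have q: "module_hom ?F ?M q"
    unfolding q_def free_rmodule_eq_finsupp by (rule module_hom_lincomb[OF module]) (simp add: f_in)
  have q\<phi>t: "q (\<phi>t x) = ?f x" for x
    unfolding q_def \<phi>t_def by (rule lincomb_coordinates[OF module map_linear e])
  have q_onto: "q ` mcarrier ?F = mcarrier ?M"
  proof
    show "q ` mcarrier ?F \<subseteq> mcarrier ?M" using q by (simp add: module_hom_def)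
    have "range ?f \<subseteq> q ` mcarrier ?F" using q\<phi>t \<phi>t_in by (metis image_eqI image_subsetI)
    from generated_submodule_least[OF submodule_image[OF right_module_free module q] this]
    show "mcarrier ?M \<subseteq> q ` mcarrier ?F" by (simp add: map_generates)
  qed
  \<comment> \<open>a section of \<open>q\<close> is a lift of the identity of \<open>M\<close>\<close>
  have "module_hom ?M ?M (\<lambda>m. m)" by (auto simp: module_hom_def)
  then obtain h where h: "module_hom ?M ?F h" and qh: "\<And>m. m \<in> mcarrier ?M \<Longrightarrow> q (h m) = m"
    using projective_module_lift[OF proj right_module_free module q q_onto] by blast
  define P where "P = h \<circ> q"
  have q_in: "q v \<in> mcarrier ?M" if "v \<in> mcarrier ?F" for v using q_onto that by blast
  have P: "projection n P"
    using module_hom_comp[OF q h] by (simp add: projection_def P_def qh q_in)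
  let ?R = "projection_range n P"
  have R: "right_module ?R" by (rule right_module_projection_range[OF P])
  have R_carrier: "mcarrier ?R = h ` mcarrier ?M"
    unfolding projection_range_def P_def image_comp[symmetric] q_onto by simp
  have R_act: "mact ?R = mact ?F" by (simp add: projection_range_def)
  have hR: "module_hom ?M ?R h" using h by (simp add: module_hom_def R_carrier R_act)
  have P\<phi>t: "P \<circ> \<phi>t = h \<circ> ?f" by (simp add: P_def fun_eq_iff q\<phi>t)
  have gen: "generated_submodule ?R (range (P \<circ> \<phi>t)) = mcarrier ?R"
    unfolding P\<phi>t image_comp[symmetric]
    by (rule generates_image[OF module R hR R_carrier[symmetric] _ map_generates])
      (use f_in in blast)
  define C' where "C' = \<lparr>crep = crep C, cmodule = ?R, cmap = P \<circ> \<phi>t\<rparr>"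
  have "real_calculus C'"
  proof (rule real_calculus.intro)
    show "faithful_hermitian_rep (crep C')" using rep by (simp add: C'_def)
    show "right_module (cmodule C')" using R by (simp add: C'_def)
    show "real_linear_into (cmodule C') (cmap C')"
      using real_linear_into_comp[OF map_linear hR] unfolding C'_def by (simp only: P\<phi>t calculus.simps)
    show "generated_submodule (cmodule C') (range (cmap C')) = mcarrier (cmodule C')"
      unfolding C'_def by (simp only: gen calculus.simps)
  qed
  moreover have "real_calculus_iso C' C id id q"
  proof -
    have psi: "psi_submodule C' id = mcarrier ?R"
      unfolding psi_submodule_def using gen by (simp add: C'_def)
    have sub: "mcarrier ?R \<subseteq> mcarrier ?F" using h by (simp add: R_carrier module_hom_def)
    have "star_algebra_hom (id :: 'a \<Rightarrow> 'a)" by (simp add: star_algebra_hom_def)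
    moreover have "lie_algebra_hom (id :: 'g \<Rightarrow> 'g)"
      by (simp add: lie_algebra_hom_def linear_id[unfolded id_def] id_def)
    moreover have "q (cmap C' x) = ?f x" for x
      using qh[OF f_in] by (simp add: C'_def P_def q\<phi>t)
    moreover have "bij_betw q (mcarrier ?R) (mcarrier ?M)"
      by (rule bij_betw_byWitness[where f' = h]) (auto simp: R_carrier qh)
    ultimately show ?thesis
      using q q_in sub unfolding real_calculus_iso_def real_calculus_hom_def psi
      by (auto simp: C'_def module_hom_def R_act subset_iff)
  qed
  then have "C' \<simeq> C" unfolding real_calculi_isomorphic_def by blast
  ultimately show ?thesis
    using \<phi>t P unfolding C'_def Let_def by blast
qed

end
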